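(* Let $i\ge1$ with $i\le\frac{2}{7}\left(r+\frac{5}{2}\right)$. Then there exists an injective map $\phi$ from the set of $(i-1)$-subsets of $[r]$ to the set of $i$-subsets of $[r]$ such that $\phi(T)$ dominates $T$ for every $(i-1)$-subset $T$.
   Context: For $\pi=a_1\cdots a_{r+1}\in S_{r+1}$, its descent set is $\{j\in[r]:a_j>a_{j+1}\}$, and $D(S)$ is the set of permutations in $S_{r+1}$ with descent set $S$. The inversion set is $I(\pi)=\{(a_j,a_k):j<k,\ a_j>a_k\}$; $\pi\le_w\pi'$ iff $I(\pi)\subseteq I(\pi')$ (weak Bruhat order). $S$ dominates $T$ if there is an injection $\psi:D(T)\to D(S)$ with $\pi\le_w\psi(\pi)$ for all $\pi\in D(T)$. *)

theory Defs
  imports Complex_Main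
begin

text \<open>Permutations of [n] = {1..n} in one-line notation, as lists a_1 ... a_n
  (list index k-1 holds a_k).\<close>
definition perms :: "nat \<Rightarrow> nat list set" where
  "perms n = {xs. distinct xs \<and> set xs = {1..n}}"

text \<open>Descent set, positions 1-indexed: j in [length-1] with a_j > a_(j+1).\<close>
definition descent_set :: "nat list \<Rightarrow> nat set" where
  "descent_set xs = {j. 1 \<le> j \<and> j < length xs \<and> xs ! (j - 1) > xs ! j}"

definition inversion_set :: "nat list \<Rightarrow> (nat \<times> nat) set" where
  "inversion_set xs = {(xs ! j, xs ! k) | j k. j < k \<and> k < length xs \<and> xs ! j > xs ! k}"

definition weak_le :: "nat list \<Rightarrow> nat list \<Rightarrow> bool" where
  "weak_le p q \<longleftrightarrow> inversion_set p \<subseteq> inversion_set q"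

definition Dset :: "nat \<Rightarrow> nat set \<Rightarrow> nat list set" where
  "Dset r S = {p \<in> perms (r + 1). descent_set p = S}"

definition dominates :: "nat \<Rightarrow> nat set \<Rightarrow> nat set \<Rightarrow> bool" where
  "dominates r S T \<longleftrightarrow> (\<exists>\<psi>. inj_on \<psi> (Dset r T) \<and> \<psi> ` Dset r T \<subseteq> Dset r S \<and>
      (\<forall>p \<in> Dset r T. weak_le p (\<psi> p)))"

end

theory Submission
  imports Defs "HOL-Combinatorics.Permutations"
begin

text \<open>A set \<open>T \<union> {j}\<close> dominates \<open>T\<close> if \<open>j - 1, j, j + 1 \<notin> T\<close>, by exchanging the entries at
  \<open>j\<close> and \<open>j + 1\<close>, and also if \<open>j - 2, j - 1, j, j + 2 \<notin> T\<close> and \<open>j + 1 \<in> T\<close> with \<open>j \<ge> 2\<close>,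
  by rearranging four consecutive entries. To choose \<open>j\<close> injectively, read \<open>T\<close> as a path that
  goes down by 5 at elements of \<open>T\<close> and up by 2 elsewhere; the bound on \<open>i\<close> makes it end at
  height at least 2. Take \<open>j\<close> to be a point of maximal height that satisfies one of the two
  criteria. If there is none, every maximum is followed by two elements of \<open>T\<close>, and the
  predecessor of the first maximum satisfies the first criterion. Inserting \<open>j\<close> lowers the rest
  of the path by 7, which is enough for \<open>j\<close> to be recovered from \<open>T \<union> {j}\<close>.\<close>

section \<open>Rearrangements of one-line notation: weak order, injectivity and descents\<close>

text \<open>The entry at old index \<open>\<sigma> u\<close> moves to index \<open>u\<close>, so an
  inversion survives exactly when its two entries keep their order. The second hypothesis demands
  this of every inverted pair.\<close>

lemma weak_le_permute_list:
  assumes "\<sigma> permutes {..<length p}"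
    and "\<And>u v. u < length p \<Longrightarrow> v < length p \<Longrightarrow> \<sigma> u < \<sigma> v \<Longrightarrow> p ! \<sigma> v < p ! \<sigma> u \<Longrightarrow> u < v"
  shows "weak_le p (permute_list \<sigma> p)"
  unfolding weak_le_def
proof
  fix z assume "z \<in> inversion_set p"
  then obtain s t where st: "z = (p ! s, p ! t)" "s < t" "t < length p" "p ! t < p ! s"
    unfolding inversion_set_def by blast
  obtain u v where uv: "s = \<sigma> u" "t = \<sigma> v"
    using permutes_surj[OF assms(1)] by (metis surjD)
  have "u < length p" "v < length p"
    using permutes_in_image[OF assms(1)] st uv by (metis lessThan_iff less_trans)+
  moreover from this have "u < v" using assms(2) st uv by blast
  ultimately show "z \<in> inversion_set (permute_list \<sigma> p)"
    unfolding inversion_set_def using st uv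
    by (intro CollectI exI[of _ u] exI[of _ v]) (simp add: permute_list_nth[OF assms(1)])
qed

lemma permute_list_inject:
  assumes "\<sigma> permutes {..<n}" "length p = n" "length q = n"
    and "permute_list \<sigma> p = permute_list \<sigma> q"
  shows "p = q"
proof (rule nth_equalityI)
  fix k assume k: "k < length p"
  obtain u where u: "k = \<sigma> u" using permutes_surj[OF assms(1)] by (metis surjD)
  then have "u < n" using permutes_in_image[OF assms(1)] k assms(2) by (metis lessThan_iff)
  moreover have "permute_list \<sigma> p ! u = permute_list \<sigma> q ! u" using assms(4) by simp
  ultimately show "p ! k = q ! k"
    using assms(1-3) u by (simp add: permute_list_nth)
qed (use assms in simp)

lemma Dset_length: "p \<in> Dset r T \<Longrightarrow> length p = Suc r"
  unfolding Dset_def perms_def by (metis (mono_tags, lifting) CollectD Suc_eq_plus1 card_atLeastAtMost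
      diff_Suc_1 distinct_card)

lemma Dset_descent:
  "p \<in> Dset r T \<Longrightarrow> k < r \<Longrightarrow> p ! Suc k < p ! k \<longleftrightarrow> Suc k \<in> T"
  using Dset_length[of p r T] unfolding Dset_def descent_set_def by force

lemma Dset_ascent:
  assumes "p \<in> Dset r T" "k < r" "Suc k \<notin> T"
  shows "p ! k < p ! Suc k"
proof -
  have "p ! k \<noteq> p ! Suc k"
    using assms Dset_length[OF assms(1)] by (simp add: Dset_def perms_def nth_eq_iff_index_eq)
  then show ?thesis using Dset_descent[OF assms(1,2)] assms(3) by linarith
qed

lemma permute_list_in_Dset:
  assumes "p \<in> Dset r T" "\<sigma> permutes {..<Suc r}" "S \<subseteq> {1..r}"
    and "\<And>k. k < r \<Longrightarrow> p ! \<sigma> (Suc k) < p ! \<sigma> k \<longleftrightarrow> Suc k \<in> S"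
  shows "permute_list \<sigma> p \<in> Dset r S"
proof -
  have len: "length p = Suc r" by (rule Dset_length[OF assms(1)])
  have "j \<in> descent_set (permute_list \<sigma> p) \<longleftrightarrow> j \<in> S" for j
  proof (cases j)
    case 0 then show ?thesis using assms(3) by (auto simp: descent_set_def)
  next
    case (Suc k)
    then show ?thesis using assms len
      by (cases "k < r") (auto simp: descent_set_def permute_list_nth)
  qed
  then show ?thesis using assms(1,2) len
    by (auto simp: Dset_def perms_def)
qed

text \<open>The rearrangement may depend on \<open>p\<close>. A fixed one acts injectively, so for
  injectivity overall it is enough that the resulting list determines which one was applied.\<close>

lemma dominates_by_permutation:
  assumes "S \<subseteq> {1..r}"
    and "\<And>p. p \<in> Dset r T \<Longrightarrow> \<sigma> p permutes {..<Suc r}"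
    and "\<And>p k. p \<in> Dset r T \<Longrightarrow> k < r \<Longrightarrow> p ! \<sigma> p (Suc k) < p ! \<sigma> p k \<longleftrightarrow> Suc k \<in> S"
    and "\<And>p u v. p \<in> Dset r T \<Longrightarrow> \<sigma> p u < \<sigma> p v \<Longrightarrow> p ! \<sigma> p v < p ! \<sigma> p u \<Longrightarrow> u < v"
    and "\<And>p q. p \<in> Dset r T \<Longrightarrow> q \<in> Dset r T \<Longrightarrow>
           (\<And>k. k \<le> r \<Longrightarrow> p ! \<sigma> p k = q ! \<sigma> q k) \<Longrightarrow> \<sigma> p = \<sigma> q"
  shows "dominates r S T"
  unfolding dominates_def
proof (intro exI[of _ "\<lambda>p. permute_list (\<sigma> p) p"] conjI ballI inj_onI)
  fix p q assume pq: "p \<in> Dset r T" "q \<in> Dset r T" "permute_list (\<sigma> p) p = permute_list (\<sigma> q) q"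
  note len = Dset_length[OF pq(1)] Dset_length[OF pq(2)]
  have "p ! \<sigma> p k = q ! \<sigma> q k" if "k \<le> r" for k
    using arg_cong[OF pq(3), of "\<lambda>x. x ! k"] len that assms(2) pq(1,2) by (simp add: permute_list_nth)
  then have "\<sigma> p = \<sigma> q" using assms(5) pq by blast
  then show "p = q" using permute_list_inject[OF assms(2)[OF pq(1)] len] pq(3) by simp
next
  show "(\<lambda>p. permute_list (\<sigma> p) p) ` Dset r T \<subseteq> Dset r S"
    using assms permute_list_in_Dset by blast
next
  fix p assume p: "p \<in> Dset r T"
  show "weak_le p (permute_list (\<sigma> p) p)"
    by (rule weak_le_permute_list) (use assms(2,4) p Dset_length[OF p] in auto)
qed

section \<open>Two local criteria for domination by \<open>insert j T\<close>\<close>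

text \<open>Within a run \<open>w < x < y < z\<close>, swapping the middle two gives
  \<open>w y x z\<close>: one new inversion, a new descent in the middle, and the ascents on both
  sides persist.\<close>

lemma dominates_insert_isolated:
  assumes "T \<subseteq> {1..r}" "j \<in> {1..r}" "j - 1 \<notin> T" "j \<notin> T" "Suc j \<notin> T"
  shows "dominates r (insert j T) T"
proof -
  obtain a where a: "j = Suc a" using assms(2) by (cases j) auto
  define \<tau> where "\<tau> = transpose a (Suc a)"
  show ?thesis
  proof (rule dominates_by_permutation[where \<sigma> = "\<lambda>_. \<tau>"])
    show "\<tau> permutes {..<Suc r}"
      unfolding \<tau>_def using assms(2) a by (intro permutes_swap_id) auto
  next
    fix p k assume p: "p \<in> Dset r T" and k: "k < r"
    have "p ! a < p ! Suc a" using Dset_ascent[OF p] assms a by simp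
    moreover have "p ! k < p ! Suc k" if "a = Suc k" using Dset_ascent[OF p] assms a that k by simp
    moreover have "p ! k < p ! Suc k" if "k = Suc a" using Dset_ascent[OF p] assms a that k by simp
    ultimately show "p ! \<tau> (Suc k) < p ! \<tau> k \<longleftrightarrow> Suc k \<in> insert j T"
      using Dset_descent[OF p k] assms a
      by (auto simp: \<tau>_def transpose_def)
  next
    fix p u v assume p: "p \<in> Dset r T" and "\<tau> u < \<tau> v" "p ! \<tau> v < p ! \<tau> u"
    moreover have "p ! a < p ! Suc a" using Dset_ascent[OF p] assms a by simp
    ultimately show "u < v" by (auto simp: \<tau>_def transpose_def split: if_splits)
  qed (use assms in auto)
qed

text \<open>Entries \<open>w < x < y > z\<close> at positions \<open>j - 1, \<dots>, j + 2\<close> are rearranged to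
  \<open>w y z x\<close>, \<open>x y z w\<close> or \<open>w y x z\<close> according as \<open>z\<close> exceeds \<open>x\<close>, lies between \<open>w\<close> and \<open>x\<close>,
  or is below \<open>w\<close>. Comparing the first of the new entries with the last two recovers the case.\<close>
lemma dominates_insert_before_descent:
  assumes "T \<subseteq> {1..r}" "2 \<le> j" "j - 2 \<notin> T" "j - 1 \<notin> T" "j \<notin> T" "Suc j \<in> T" "Suc (Suc j) \<notin> T"
  shows "dominates r (insert j T) T"
proof -
  \<comment> \<open>List index \<open>a\<close> is position \<open>j - 1\<close>, where the window
    \<open>w x y z\<close> starts. The maps below send a new index to the old one, so they produce
    \<open>w y z x\<close>, \<open>x y z w\<close> and \<open>w y x z\<close> in turn.\<close>
  define a where "a = j - 2"
  have a: "j = Suc (Suc a)" and ar: "Suc (Suc a) < r" using assms by (auto simp: a_def)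
  define \<sigma>1 where "\<sigma>1 = id(Suc a := Suc (Suc a), Suc (Suc a) := Suc (Suc (Suc a)), Suc (Suc (Suc a)) := Suc a)"
  define \<sigma>2 where "\<sigma>2 = id(a := Suc a, Suc a := Suc (Suc a), Suc (Suc a) := Suc (Suc (Suc a)), Suc (Suc (Suc a)) := a)"
  define \<sigma>3 where "\<sigma>3 = id(Suc a := Suc (Suc a), Suc (Suc a) := Suc a)"
  define \<sigma> where "\<sigma> p = (if p ! (Suc a) < p ! (Suc (Suc (Suc a))) then \<sigma>1
    else if p ! a < p ! (Suc (Suc (Suc a))) then \<sigma>2 else \<sigma>3)" for p :: "nat list"
  have window: "p ! a < p ! (Suc a)" "p ! (Suc a) < p ! (Suc (Suc a))" "p ! (Suc (Suc (Suc a))) < p ! (Suc (Suc a))"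
    "p ! (Suc (Suc (Suc a))) \<noteq> p ! (Suc a)" "p ! (Suc (Suc (Suc a))) \<noteq> p ! a"
    if p: "p \<in> Dset r T" for p
  proof -
    show "p ! a < p ! (Suc a)" "p ! (Suc a) < p ! (Suc (Suc a))"
      using Dset_ascent[OF p, of a] Dset_ascent[OF p, of "Suc a"] assms a ar by auto
    show "p ! (Suc (Suc (Suc a))) < p ! (Suc (Suc a))"
      using Dset_descent[OF p, of "Suc (Suc a)"] assms a ar by auto
    show "p ! (Suc (Suc (Suc a))) \<noteq> p ! (Suc a)" "p ! (Suc (Suc (Suc a))) \<noteq> p ! a"
      using p Dset_length[OF p] ar by (auto simp: Dset_def perms_def nth_eq_iff_index_eq)
  qed
  show ?thesis
  proof (rule dominates_by_permutation[where \<sigma> = \<sigma>])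
    fix p
    have permutesI: "inj_on f {..<Suc r} \<Longrightarrow> f ` {..<Suc r} \<subseteq> {..<Suc r} \<Longrightarrow> (\<And>x. x \<ge> Suc r \<Longrightarrow> f x = x)
       \<Longrightarrow> f permutes {..<Suc r}" for f :: "nat \<Rightarrow> nat"
      by (intro bij_imp_permutes) (auto simp: bij_betw_def endo_inj_surj)
    show "\<sigma> p permutes {..<Suc r}"
      by (rule permutesI; use ar in \<open>auto simp: \<sigma>_def \<sigma>1_def \<sigma>2_def \<sigma>3_def inj_on_def\<close>)
  next
    fix p k assume p: "p \<in> Dset r T" and k: "k < r"
    have left: "p ! k < p ! Suc k" if "a = Suc k"
      using Dset_ascent[OF p k] assms a that by simp
    have right: "p ! k < p ! Suc k" if "k = Suc (Suc (Suc a))"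
      using Dset_ascent[OF p k] assms a that by simp
    have pos: "Suc k < a \<or> Suc k = a \<or> k = a \<or> k = Suc a \<or> k = Suc (Suc a) \<or>
        k = Suc (Suc (Suc a)) \<or> Suc (Suc (Suc a)) < k"
      by linarith
    note facts = left right Dset_descent[OF p k] window[OF p] assms(5,6) a
    consider "\<sigma> p = \<sigma>1" "p ! Suc a < p ! Suc (Suc (Suc a))"
      | "\<sigma> p = \<sigma>2" "p ! a < p ! Suc (Suc (Suc a))" "p ! Suc (Suc (Suc a)) < p ! Suc a"
      | "\<sigma> p = \<sigma>3" "p ! Suc (Suc (Suc a)) < p ! a"
      using window[OF p] unfolding \<sigma>_def by (metis linorder_neqE_nat)
    then show "p ! \<sigma> p (Suc k) < p ! \<sigma> p k \<longleftrightarrow> Suc k \<in> insert j T"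
    proof cases
      case 1
      show ?thesis using pos
        by (elim disjE) (use 1 facts in \<open>auto simp: \<sigma>1_def\<close>)
    next
      case 2
      show ?thesis using pos
        by (elim disjE) (use 2 facts in \<open>auto simp: \<sigma>2_def\<close>)
    next
      case 3
      show ?thesis using pos
        by (elim disjE) (use 3 facts in \<open>auto simp: \<sigma>3_def\<close>)
    qed
  next
    fix p u v assume p: "p \<in> Dset r T" and "\<sigma> p u < \<sigma> p v" "p ! \<sigma> p v < p ! \<sigma> p u"
    then show "u < v" using window[OF p]
      by (auto simp: \<sigma>_def \<sigma>1_def \<sigma>2_def \<sigma>3_def split: if_splits)
  next
    fix p q assume pq: "p \<in> Dset r T" "q \<in> Dset r T"
      and eq: "\<And>k. k \<le> r \<Longrightarrow> p ! \<sigma> p k = q ! \<sigma> q k"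
    \<comment> \<open>The first new entry lies below both of the last two for
      \<open>\<sigma>1\<close>, above both for \<open>\<sigma>2\<close>, and between them for
      \<open>\<sigma>3\<close>.\<close>
    have "p ! \<sigma> p a = q ! \<sigma> q a" "p ! \<sigma> p (Suc (Suc a)) = q ! \<sigma> q (Suc (Suc a))"
      "p ! \<sigma> p (Suc (Suc (Suc a))) = q ! \<sigma> q (Suc (Suc (Suc a)))"
      using ar by (auto intro!: eq)
    then show "\<sigma> p = \<sigma> q" using window[OF pq(1)] window[OF pq(2)]
      by (auto simp: \<sigma>_def \<sigma>1_def \<sigma>2_def \<sigma>3_def split: if_splits)
  qed (use assms in auto)
qed

section \<open>The lattice path of a set and the choice of the inserted element\<close>

definition height :: "nat set \<Rightarrow> nat \<Rightarrow> int" where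
  "height T t = 2 * int t - 7 * int (card (T \<inter> {1..t}))"

lemma height_0 [simp]: "height T 0 = 0"
  by (simp add: height_def)

lemma height_Suc: "height T (Suc t) = height T t + (if Suc t \<in> T then - 5 else 2)"
proof -
  have "T \<inter> {1..Suc t} = (if Suc t \<in> T then insert (Suc t) (T \<inter> {1..t}) else T \<inter> {1..t})"
    by (auto simp: le_Suc_eq)
  then show ?thesis by (simp add: height_def)
qed

lemma height_insert:
  assumes "j \<notin> T" "1 \<le> j"
  shows "height (insert j T) t = height T t - (if j \<le> t then 7 else 0)"
proof -
  have "insert j T \<inter> {1..t} = (if j \<le> t then insert j (T \<inter> {1..t}) else T \<inter> {1..t})"
    using assms by auto
  then show ?thesis using assms by (simp add: height_def)
qed

text \<open>\<open>M\<close> is the maximal height. The first alternative is the case where \<open>j\<close> attains it, the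
  second one the case where \<open>j + 1\<close> is the first position to do so.\<close>
definition insertion_point :: "nat \<Rightarrow> nat set \<Rightarrow> nat \<Rightarrow> int \<Rightarrow> bool" where
  "insertion_point r T j M \<longleftrightarrow> j \<in> {1..r} \<and> j \<notin> T \<and> (\<forall>t\<le>r. height T t \<le> M) \<and>
     (height T (j - 1) = M - 2 \<or>
      height T (j - 1) = M - 4 \<and> (\<forall>t<j. height T t < M) \<and> Suc j \<notin> T \<and>
      (\<forall>t\<le>r. height T t = M \<and> Suc t \<in> T \<longrightarrow> Suc (Suc t) \<in> T))"

text \<open>The two paths agree at \<open>j - 1\<close>, but at \<open>j' - 1\<close> that of
  \<open>T\<close> is 7 higher. Drops of 2 or 4 below the maxima almost forbid this; the conditions
  of the second alternative exclude what remains.\<close>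

lemma insertion_point_inject_aux:
  assumes ip: "insertion_point r T j M" "insertion_point r T' j' M'"
    and eq: "insert j T = insert j' T'" and less: "j < j'"
  shows False
proof -
  have j: "1 \<le> j" "j' \<le> r" "j \<notin> T" "j' \<notin> T'" using ip by (auto simp: insertion_point_def)
  have "height T t - (if j \<le> t then 7 else 0) = height T' t - (if j' \<le> t then 7 else 0)" for t
    using height_insert[OF j(3,1), of t] height_insert[OF j(4), of t] j less eq by auto
  from this[of "j - 1"] this[of "j' - 1"]
  have h: "height T (j - 1) = height T' (j - 1)" "height T (j' - 1) - 7 = height T' (j' - 1)"
    using j less by (auto split: if_splits)
  have le: "height T (j' - 1) \<le> M" "height T' (j - 1) \<le> M'"
    using ip j less by (auto simp: insertion_point_def)
  \<comment> \<open>The bounds give M' + 3 \<le> M \<le> M' + 4. The first alternative for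
    \<open>T\<close> would force M \<le> M' + 2, and for \<open>T'\<close> it would force M \<ge> M'
    + 5.\<close>
  then have lower: "height T (j - 1) = M - 4" "height T' (j' - 1) = M' - 4"
    and B: "\<forall>t\<le>r. height T t = M \<and> Suc t \<in> T \<longrightarrow> Suc (Suc t) \<in> T"
    and B': "\<forall>t<j'. height T' t < M'" "Suc j' \<notin> T'"
    using ip h unfolding insertion_point_def by smt+
  \<comment> \<open>Strictness rules out M = M' + 4, so M = M' + 3 and the path of \<open>T\<close>
    is maximal at \<open>j' - 1\<close>.\<close>
  have "height T' (j - 1) < M'" using B' less by simp
  then have "height T (j' - 1) = M" using h lower le by linarith
  moreover have "j' \<in> T" using eq less by auto
  ultimately have "Suc j' \<in> T" using B[rule_format, of "j' - 1"] j less by auto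
  then have "Suc j' \<in> insert j' T'" using eq by blast
  then show False using B'(2) by simp
qed

lemma insertion_point_inject:
  assumes "insertion_point r T j M" "insertion_point r T' j' M'" "insert j T = insert j' T'"
  shows "T = T'"
proof -
  have "j = j'"
    using insertion_point_inject_aux assms by (metis linorder_neqE_nat)
  then show ?thesis using assms unfolding insertion_point_def by (metis insert_ident)
qed

lemma insertion_point_exists:
  assumes T: "T \<subseteq> {1..r}" and card: "7 * card T + 2 \<le> 2 * r"
  shows "\<exists>j M. insertion_point r T j M \<and> dominates r (insert j T) T"
proof -
  define M where "M = Max (height T ` {..r})"
  have le: "height T t \<le> M" if "t \<le> r" for t
    unfolding M_def using that by (intro Max_ge) auto
  have "M \<in> height T ` {..r}" unfolding M_def by (intro Max_in) auto
  then obtain t0 where t0: "t0 \<le> r" "height T t0 = M" by auto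
  have "T \<inter> {1..r} = T" using T by auto
  then have hr: "2 \<le> height T r" using card by (simp add: height_def)
  then have M2: "2 \<le> M" using le[of r] by simp
  \<comment> \<open>Index 0 has height 0 < M. Going back from a maximum, a down-step at
    \<open>t\<close>, \<open>t - 1\<close> or \<open>t - 2\<close> would have started at height M +
    5, M + 3 or M + 1.\<close>
  have left: "t \<noteq> 0 \<and> t \<notin> T \<and> t - 1 \<notin> T \<and> t - 2 \<notin> T \<and> height T (t - 1) = M - 2"
    if t: "t \<le> r" "height T t = M" for t
  proof -
    obtain s where s: "t = Suc s" using t M2 by (cases t) auto
    have s_notin: "t \<notin> T" using height_Suc[of T s] le[of s] s t by (auto split: if_splits)
    then have hs: "height T s = M - 2" using height_Suc[of T s] s t by simp
    have "0 \<notin> T" using T by auto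
    have "s \<notin> T \<and> s - 1 \<notin> T"
    proof (cases s)
      case 0 then show ?thesis using \<open>0 \<notin> T\<close> by simp
    next
      case (Suc u)
      have "s \<notin> T" using height_Suc[of T u] le[of u] s Suc t hs by (auto split: if_splits)
      moreover from this have "height T u = M - 4" using height_Suc[of T u] Suc hs by simp
      moreover from this have "u \<notin> T"
        using height_Suc[of T "u - 1"] le[of "u - 1"] s Suc t \<open>0 \<notin> T\<close>
        by (cases u) (auto split: if_splits)
      ultimately show ?thesis using Suc by simp
    qed
    then show ?thesis using s s_notin hs by (simp add: numeral_2_eq_2)
  qed
  have right: "Suc t \<in> T" if "t < r" "height T t = M" for t
    using height_Suc[of T t] le[of "Suc t"] that by (auto split: if_splits)
  show ?thesis
  \<comment> \<open>A maximum at \<open>r\<close> meets the isolated criterion. One before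
    \<open>r\<close> is followed by an element of \<open>T\<close>, and meets the other criterion if
    \<open>t + 2\<close> is not in \<open>T\<close>.\<close>
  proof (cases "\<exists>t\<le>r. height T t = M \<and> (t = r \<or> 2 \<le> t \<and> Suc (Suc t) \<notin> T)")
    case True
    then obtain t where t: "t \<le> r" "height T t = M" "t = r \<or> 2 \<le> t \<and> Suc (Suc t) \<notin> T" by blast
    have "insertion_point r T t M"
      using left[OF t(1,2)] le t by (auto simp: insertion_point_def)
    moreover have "dominates r (insert t T) T"
    proof (cases "t = r")
      case True
      then show ?thesis using left[OF t(1,2)] T by (intro dominates_insert_isolated) auto
    next
      case False
      then show ?thesis using left[OF t(1,2)] right[of t] T t
        by (intro dominates_insert_before_descent) auto
    qed
    ultimately show ?thesis by blast
  next
    case False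
    then have "height T r \<noteq> M" by auto
    \<comment> \<open>Heights at 0 and 1 are at most 2, so now every maximum lies at some
      \<open>t \<ge> 2\<close>, and the failed case condition puts \<open>t + 2\<close> in
      \<open>T\<close>.\<close>
    then have M3: "2 < M" using le[of r] hr by simp
    have ge2: "2 \<le> t" if "t \<le> r" "height T t = M" for t
    proof (rule ccontr)
      assume "\<not> 2 \<le> t"
      then have "t = 0 \<or> t = Suc 0" by auto
      then show False using that M3 height_Suc[of T 0] by (auto split: if_splits)
    qed
    \<comment> \<open>None of \<open>t - 2\<close>, \<open>t - 1\<close>, \<open>t\<close> is in
      \<open>T\<close>, so \<open>t - 1\<close> is isolated; minimality of \<open>t\<close> supplies
      the strict bound before it.\<close>
    define t where "t = (LEAST t. height T t = M)"
    have t: "height T t = M" unfolding t_def by (rule LeastI[of _ t0]) (rule t0)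
    have tr: "t \<le> r" unfolding t_def using Least_le[of _ t0] t0 by (metis (mono_tags, lifting) le_trans)
    have first: "height T s < M" if "s < t" for s
      using not_less_Least[of s "\<lambda>t. height T t = M"] le[of s] that tr t_def by fastforce
    note l = left[OF tr t]
    have t2: "2 \<le> t" using ge2 tr t by blast
    then obtain s where s: "t = Suc (Suc s)" by (metis add_2_eq_Suc le_Suc_ex)
    have "height T s = M - 4" using l s height_Suc[of T s] by auto
    then have "insertion_point r T (t - 1) M"
      using l le first t2 s tr False ge2 by (auto simp: insertion_point_def)
    moreover have "dominates r (insert (t - 1) T) T"
      using l s T tr by (intro dominates_insert_isolated) auto
    ultimately show ?thesis by blast
  qed
qed

theorem theorem6p2:
  fixes r i :: nat
  assumes "1 \<le> i" and "real i \<le> 2 / 7 * (real r + 5 / 2)"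
  shows "\<exists>\<phi>. inj_on \<phi> {T. T \<subseteq> {1..r} \<and> card T = i - 1}
           \<and> \<phi> ` {T. T \<subseteq> {1..r} \<and> card T = i - 1} \<subseteq> {S. S \<subseteq> {1..r} \<and> card S = i}
           \<and> (\<forall>T. T \<subseteq> {1..r} \<and> card T = i - 1 \<longrightarrow> dominates r (\<phi> T) T)"
proof -
  let ?A = "{T. T \<subseteq> {1..r} \<and> card T = i - 1}"
  have "real (7 * i) \<le> real (2 * r + 5)" using assms(2) by simp
  then have "7 * i \<le> 2 * r + 5" by linarith
  \<comment> \<open>For sets of size \<open>i - 1\<close> this says that the path ends at height at
    least 2.\<close>
  then have "7 * (i - 1) + 2 \<le> 2 * r" using assms(1) by simp
  then have "\<forall>T\<in>?A. \<exists>j. (\<exists>M. insertion_point r T j M) \<and> dominates r (insert j T) T"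
    using insertion_point_exists by auto
  from bchoice[OF this] obtain j
    where j: "\<And>T. T \<in> ?A \<Longrightarrow> \<exists>M. insertion_point r T (j T) M"
      and dom: "\<And>T. T \<in> ?A \<Longrightarrow> dominates r (insert (j T) T) T"
    by blast
  show ?thesis
  proof (intro exI[of _ "\<lambda>T. insert (j T) T"] conjI)
    show "inj_on (\<lambda>T. insert (j T) T) ?A"
    proof (rule inj_onI)
      fix T T' assume T: "T \<in> ?A" "T' \<in> ?A" and eq: "insert (j T) T = insert (j T') T'"
      obtain M M' where "insertion_point r T (j T) M" "insertion_point r T' (j T') M'"
        using j T by meson
      then show "T = T'" using eq by (rule insertion_point_inject)
    qed
    show "(\<lambda>T. insert (j T) T) ` ?A \<subseteq> {S. S \<subseteq> {1..r} \<and> card S = i}"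
    proof (rule image_subsetI)
      fix T assume T: "T \<in> ?A"
      then have "finite T" by (auto dest: finite_subset)
      moreover have "j T \<in> {1..r}" "j T \<notin> T"
        using j[OF T] by (auto simp: insertion_point_def)
      ultimately show "insert (j T) T \<in> {S. S \<subseteq> {1..r} \<and> card S = i}"
        using T assms(1) by auto
    qed
  qed (use dom in blast)
qed

end
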